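(* Let $N \geq 1$ be an integer. For real $\alpha \ge N$ let $$F_{\alpha,N} = \{ x \in (0,1) \setminus \mathbb{Q} : \varepsilon_n(x) \geq \alpha \text{ for all } n \geq 1 \},$$ where $\varepsilon_n(x)$ are the $N$-expansion digits of $x$. Then for every real $\alpha$ with $\log(\alpha-1) > \exp(1+N)$, $$\frac12 + \frac{1}{2\log(\alpha+2)} \;\leq\; \dim_H(F_{\alpha,N}) \;\leq\; \frac12 + \frac{\log\log(\alpha-1)}{2\log(\alpha-1)}.$$ Consequently, $\lim_{\alpha \to \infty} \dim_H(F_{\alpha,N}) = \frac12$, and for sufficiently large $\alpha$ (depending on $N$) the bounds become independent of $N$, converging to $1/2$ from above at a logarithmic rate.
   Context: Fix an integer $N\ge 1$. The $N$-expansion transformation $T_N:[0,1]\to[0,1]$ is $T_N(x) = \frac{N}{x} - \lfloor \frac{N}{x}\rfloor$ for $x\ne 0$, and $T_N(0)=0$. For irrational $x\in(0,1)$, the $N$-expansion digits are $\varepsilon_n(x) = \lfloor N / T_N^{n-1}(x)\rfloor$, $n\ge 1$; they are integers $\ge N$, and $x = \cfrac{N}{\varepsilon_1+\cfrac{N}{\varepsilon_2+\ddots}}$. $\dim_H$ denotes Hausdorff dimension and $\log$ the natural logarithm. "The bounds" in the last sentence of the claim are the lower and upper bounds for $\dim_H(F_{\alpha,N})$ in the displayed inequality. *)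

theory Defs
  imports "HOL-Analysis.Analysis" "HOL-Library.Landau_Symbols"
begin

section \<open>Hausdorff measure and Hausdorff dimension\<close>

text \<open>
  The term \<open>(diam U)^s\<close> of the Hausdorff sums, with the conventions \<open>(diam {})^s = 0\<close> for all \<open>s\<close>
  and \<open>(diam U)^0 = 1\<close> for nonempty \<open>U\<close>. The latter needs a separate case because
  \<open>0 powr 0 = 0\<close>.
\<close>

definition diam_powr :: "real \<Rightarrow> 'a::metric_space set \<Rightarrow> ennreal" where
  "diam_powr s U =
     (if U = {} then 0 else if s = 0 then 1 else ennreal (diameter U powr s))"

text \<open>
  Finite covers are included, as covers padded with empty sets. Boundedness is required
  explicitly because \<^const>\<open>diameter\<close> is real-valued, hence not meaningful on unbounded sets.
\<close>

definition hausdorff_premeasure :: "real \<Rightarrow> real \<Rightarrow> 'a::metric_space set \<Rightarrow> ennreal" where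
  "hausdorff_premeasure s \<delta> A =
     (INF U \<in> {U :: nat \<Rightarrow> 'a set. A \<subseteq> (\<Union>i. U i) \<and> (\<forall>i. bounded (U i) \<and> diameter (U i) \<le> \<delta>)}.
        (\<Sum>i. diam_powr s (U i)))"

definition hausdorff_measure :: "real \<Rightarrow> 'a::metric_space set \<Rightarrow> ennreal" where
  "hausdorff_measure s A = (SUP \<delta> \<in> {0<..}. hausdorff_premeasure s \<delta> A)"

definition hausdorff_dim :: "'a::metric_space set \<Rightarrow> ereal" where
  "hausdorff_dim A = Inf {ereal s |s. 0 \<le> s \<and> hausdorff_measure s A = 0}"

section \<open>\<open>N\<close>-expansions\<close>

text \<open>The transformation is total on the reals here; it is only ever iterated on \<open>[0,1]\<close>.\<close>

definition N_map :: "nat \<Rightarrow> real \<Rightarrow> real" where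
  "N_map N x = (if x = 0 then 0 else real N / x - of_int \<lfloor>real N / x\<rfloor>)"

text \<open>The digits are indexed by \<open>n \<ge> 1\<close>; the value at \<open>n = 0\<close> is irrelevant.\<close>

definition N_digit :: "nat \<Rightarrow> nat \<Rightarrow> real \<Rightarrow> int" where
  "N_digit N n x = \<lfloor>real N / (N_map N ^^ (n - 1)) x\<rfloor>"

definition F_set :: "real \<Rightarrow> nat \<Rightarrow> real set" where
  "F_set \<alpha> N = {x \<in> {0<..<1} - \<rat>. \<forall>n\<ge>1. real_of_int (N_digit N n x) \<ge> \<alpha>}"

section \<open>The two bounds\<close>

text \<open>
  The library's real logarithm satisfies \<open>ln (-x) = ln x\<close>, so conditions such as
  \<open>ln (\<alpha> - 1) > c\<close> must be accompanied by a lower bound on \<open>\<alpha>\<close>.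
\<close>

definition lower_bound :: "real \<Rightarrow> real" where
  "lower_bound \<alpha> = 1 / 2 + 1 / (2 * ln (\<alpha> + 2))"

definition upper_bound :: "real \<Rightarrow> real" where
  "upper_bound \<alpha> = 1 / 2 + ln (ln (\<alpha> - 1)) / (2 * ln (\<alpha> - 1))"

end

theory Submission
  imports Defs "HOL-Real_Asymp.Real_Asymp"
begin

text \<open>
  Points of \<open>F\<^sub>\<alpha>\<^sub>,\<^sub>N\<close> are the values of the branches \<open>y \<mapsto> N / (e + y)\<close> with \<open>e \<ge> \<alpha>\<close> at points of the same
  set, and such a branch contracts distances in \<open>[0,1]\<close> by a factor between \<open>N / (e + 1)\<^sup>2\<close> and \<open>N / e\<^sup>2\<close>.

  Upper bound: pushing a cover forward along all branches multiplies its \<open>s\<close>-sum by at most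
  \<open>\<Sum>e\<ge>\<alpha>. (N / e\<^sup>2)\<^sup>s\<close>, so the \<open>s\<close>-dimensional measure vanishes as soon as this sum is less than 1.

  Lower bound: restrict to finitely many digits with \<open>\<Sum>e. (N / (e + 1)\<^sup>2)\<^sup>s \<ge> 1\<close>; the resulting limit set
  is compact with separated pieces. In a finite cover by small sets every set meets only one piece,
  and some piece \<open>e\<close> uses at most the share \<open>(N / (e + 1)\<^sup>2)\<^sup>s\<close> of the \<open>s\<close>-sum. Pulling that part of the
  cover back along branch \<open>e\<close> gives a cover with fewer sets and no larger \<open>s\<close>-sum, which cannot be
  repeated forever. Hence the \<open>s\<close>-sum of a cover is bounded away from 0.

  Both digit sums are compared with \<open>\<integral> x\<^sup>-\<^sup>2\<^sup>s dx\<close>.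
\<close>

section \<open>Powers compared with integrals over unit intervals\<close>

text \<open>By the mean value theorem the quotient equals \<open>z powr (-1 - \<theta>)\<close> for
  some \<open>z\<close> between \<open>x\<close> and \<open>x + 1\<close>, and this power decreases
  in \<open>z\<close>. The first bound yields a telescoping majorant of digit sums, the second a
  telescoping minorant.\<close>

lemma powr_diff_bounds:
  fixes x \<theta> :: real
  assumes "0 < x" "0 < \<theta>"
  shows "(x + 1) powr (-1 - \<theta>) \<le> (x powr (-\<theta>) - (x + 1) powr (-\<theta>)) / \<theta>"
    and "(x powr (-\<theta>) - (x + 1) powr (-\<theta>)) / \<theta> \<le> x powr (-1 - \<theta>)"
proof -
  have "((\<lambda>t. t powr (-\<theta>)) has_real_derivative (-\<theta>) * t powr (-\<theta> - 1)) (at t)" if "x \<le> t" for t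
    using that assms by (auto intro!: derivative_eq_intros)
  then obtain z where z: "x < z" "z < x + 1"
      "(x + 1) powr (-\<theta>) - x powr (-\<theta>) = (x + 1 - x) * ((-\<theta>) * z powr (-\<theta> - 1))"
    using MVT2[of x "x + 1" "\<lambda>t. t powr (-\<theta>)" "\<lambda>t. (-\<theta>) * t powr (-\<theta> - 1)"] by auto
  moreover have "-\<theta> - 1 = -1 - \<theta>" by simp
  ultimately have "(x + 1) powr (-\<theta>) - x powr (-\<theta>) = -\<theta> * z powr (-1 - \<theta>)"
    by (simp only:) simp
  then have eq: "(x powr (-\<theta>) - (x + 1) powr (-\<theta>)) / \<theta> = z powr (-1 - \<theta>)"
    using assms by (simp add: field_simps)
  show "(x + 1) powr (-1 - \<theta>) \<le> (x powr (-\<theta>) - (x + 1) powr (-\<theta>)) / \<theta>"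
    unfolding eq using z assms by (intro powr_mono2') auto
  show "(x powr (-\<theta>) - (x + 1) powr (-\<theta>)) / \<theta> \<le> x powr (-1 - \<theta>)"
    unfolding eq using z assms by (intro powr_mono2') auto
qed

section \<open>Hausdorff measure of attractors\<close>

text \<open>The Lipschitz bound is asked for on \<open>V\<close> only, so that a covering set can be
  cut down to its part in the attractor before it is mapped.\<close>

lemma bounded_diameter_image_le:
  fixes f :: "'a::metric_space \<Rightarrow> 'b::metric_space"
  assumes "bounded U" "0 \<le> c"
    and lip: "\<And>x y. x \<in> V \<Longrightarrow> y \<in> V \<Longrightarrow> dist (f x) (f y) \<le> c * dist x y"
    and "V \<subseteq> U"
  shows "bounded (f ` V)" "diameter (f ` V) \<le> c * diameter U"
proof -
  have *: "dist u v \<le> c * diameter U" if uv: "u \<in> f ` V" "v \<in> f ` V" for u v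
  proof -
    obtain x y where xy: "x \<in> V" "y \<in> V" "u = f x" "v = f y"
      using uv by blast
    have "dist u v \<le> c * dist x y" using lip xy by auto
    also have "\<dots> \<le> c * diameter U"
      using assms xy by (intro mult_left_mono diameter_bounded_bound) auto
    finally show ?thesis .
  qed
  show b: "bounded (f ` V)"
    unfolding bounded_two_points using * by blast
  show "diameter (f ` V) \<le> c * diameter U"
  proof (rule ccontr)
    assume "\<not> ?thesis"
    then have "c * diameter U < diameter (f ` V)" by simp
    moreover have "0 \<le> c * diameter U" using assms(1,2) diameter_ge_0 by (intro mult_nonneg_nonneg)
    moreover obtain d where d: "c * diameter U < d" "d < diameter (f ` V)"
      using dense calculation(1) by blast
    ultimately have "0 < d" by linarith
    obtain u v where "u \<in> f ` V" "v \<in> f ` V" "d < dist u v"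
      using diameter_lower_bounded[OF b \<open>0 < d\<close> d(2)] by blast
    with *[of u v] d(1) show False by simp
  qed
qed

lemma diam_powr_le:
  assumes "0 < s" "bounded V" "0 \<le> c" "diameter V \<le> c * diameter U" "bounded U" "U = {} \<Longrightarrow> V = {}"
  shows "diam_powr s V \<le> ennreal (c powr s) * diam_powr s U"
proof (cases "V = {}")
  case False
  then have "U \<noteq> {}" using assms by auto
  have "diameter V powr s \<le> (c * diameter U) powr s"
    using assms diameter_ge_0 by (intro powr_mono2) auto
  also have "\<dots> = c powr s * diameter U powr s"
    using assms diameter_ge_0 by (simp add: powr_mult)
  finally show ?thesis
    using False \<open>U \<noteq> {}\<close> \<open>0 < s\<close>
    by (simp add: diam_powr_def ennreal_mult[symmetric] ennreal_leI)
qed (simp add: diam_powr_def)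

lemma hausdorff_premeasure_le:
  assumes "A \<subseteq> (\<Union>i. U i)" "\<And>i. bounded (U i)" "\<And>i. diameter (U i) \<le> \<delta>"
  shows "hausdorff_premeasure s \<delta> A \<le> (\<Sum>i. diam_powr s (U i))"
  unfolding hausdorff_premeasure_def by (rule INF_lower) (use assms in auto)

lemma hausdorff_premeasure_mono:
  assumes "A \<subseteq> B"
  shows "hausdorff_premeasure s \<delta> A \<le> hausdorff_premeasure s \<delta> B"
  unfolding hausdorff_premeasure_def by (rule INF_superset_mono) (use assms in auto)

text \<open>Diameters are at most 1 here, and powers of such numbers decrease as the exponent
  grows.\<close>

lemma hausdorff_premeasure_le_exponent:
  assumes "0 \<le> t" "t \<le> s" "\<delta> \<le> 1"
  shows "hausdorff_premeasure s \<delta> A \<le> hausdorff_premeasure t \<delta> A"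
  unfolding hausdorff_premeasure_def
proof (rule INF_mono, rule bexI)
  fix U :: "nat \<Rightarrow> 'a set"
  assume U: "U \<in> {U. A \<subseteq> (\<Union>i. U i) \<and> (\<forall>i. bounded (U i) \<and> diameter (U i) \<le> \<delta>)}"
  have "diam_powr s (U i) \<le> diam_powr t (U i)" for i
  proof -
    have d: "0 \<le> diameter (U i)" "diameter (U i) \<le> 1"
      using U assms diameter_ge_0[of "U i"] by (auto intro: order.trans)
    have "diameter (U i) powr s \<le> diameter (U i) powr t"
      using assms d by (intro powr_mono') auto
    \<comment> \<open>This handles \<open>t = 0\<close>, where every nonempty set contributes
      1.\<close>
    moreover have "diameter (U i) powr s \<le> 1"
      using assms d powr_le1 by simp
    ultimately show ?thesis
      using assms by (auto simp: diam_powr_def ennreal_leI simp flip: ennreal_1)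
  qed
  then show "(\<Sum>i. diam_powr s (U i)) \<le> (\<Sum>i. diam_powr t (U i))"
    by (intro suminf_le) auto
qed

text \<open>One scale suffices: the measure is a supremum over all scales, so measure zero at
  \<open>t\<close> makes the premeasure at scale 1 vanish, and monotonicity in the exponent then
  excludes \<open>t \<le> s\<close>.\<close>

lemma hausdorff_dim_geI:
  assumes "0 < hausdorff_premeasure s 1 A"
  shows "ereal s \<le> hausdorff_dim A"
  unfolding hausdorff_dim_def
proof (rule Inf_greatest, safe)
  fix t :: real assume t: "0 \<le> t" "hausdorff_measure t A = 0"
  have "hausdorff_premeasure t 1 A \<le> hausdorff_measure t A"
    unfolding hausdorff_measure_def by (rule SUP_upper) auto
  then have "hausdorff_premeasure t 1 A = 0" using t by simp
  then have "\<not> t \<le> s" using hausdorff_premeasure_le_exponent[OF t(1), of s 1 A] assms by auto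
  then show "ereal s \<le> ereal t" by simp
qed

section \<open>Vanishing measure for contracting families\<close>

text \<open>The new cover consists of the images under \<open>f e\<close> of
  \<open>U i \<inter> F\<close>, for all pairs \<open>(e, i)\<close>; its \<open>s\<close>-sum is
  bounded by a double series that factors.\<close>

lemma contracted_cover:
  fixes f :: "nat \<Rightarrow> 'a::metric_space \<Rightarrow> 'a"
  assumes F: "F \<subseteq> (\<Union>e. f e ` F)"
    and lip: "\<And>e x y. x \<in> F \<Longrightarrow> y \<in> F \<Longrightarrow> dist (f e x) (f e y) \<le> c e * dist x y"
    and c: "\<And>e. 0 \<le> c e" "\<And>e. c e \<le> q" and "0 < s"
    and U: "F \<subseteq> (\<Union>i. U i)" "\<And>i. bounded (U i)" "\<And>i. diameter (U i) \<le> \<delta>"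
  obtains V where "F \<subseteq> (\<Union>i. V i)" "\<And>i. bounded (V i)" "\<And>i::nat. diameter (V i) \<le> q * \<delta>"
    "(\<Sum>i. diam_powr s (V i)) \<le> (\<Sum>e. ennreal (c e powr s)) * (\<Sum>i. diam_powr s (U i))"
proof
  define W where "W = (\<lambda>(e, i). f e ` (U i \<inter> F))"
  let ?V = "\<lambda>n. W (prod_decode n)"
  have bd: "bounded (W (e, i))" "diameter (W (e, i)) \<le> c e * diameter (U i)" for e i
    using bounded_diameter_image_le[of "U i" "c e" "U i \<inter> F" "f e"] U c lip by (auto simp: W_def)
  show "F \<subseteq> (\<Union>i. ?V i)"
  proof
    fix x assume "x \<in> F"
    then obtain e y where ey: "y \<in> F" "x = f e y" using F by auto
    then obtain i where "y \<in> U i" using U by auto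
    then have "x \<in> ?V (prod_encode (e, i))" using ey by (auto simp: W_def)
    then show "x \<in> (\<Union>i. ?V i)" by blast
  qed
  show "bounded (?V n)" for n
    using bd by (cases "prod_decode n") simp
  show "diameter (?V n) \<le> q * \<delta>" for n
  proof (cases "prod_decode n")
    case (Pair e i)
    have "diameter (W (e, i)) \<le> c e * diameter (U i)" using bd by simp
    also have "\<dots> \<le> q * \<delta>"
      using c U diameter_ge_0[of "U i"] order.trans[OF c(1) c(2)] by (intro mult_mono) auto
    finally show ?thesis using Pair by simp
  qed
  have "(\<Sum>n. diam_powr s (?V n)) = (\<Sum>e. \<Sum>i. diam_powr s (W (e, i)))"
    by (rule suminf_ennreal_2dimen) simp
  also have "\<dots> \<le> (\<Sum>e. \<Sum>i. ennreal (c e powr s) * diam_powr s (U i))"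
    using bd c U \<open>0 < s\<close> by (intro suminf_le diam_powr_le) (auto simp: W_def)
  also have "\<dots> = (\<Sum>e. ennreal (c e powr s)) * (\<Sum>i. diam_powr s (U i))"
    by simp
  finally show "(\<Sum>n. diam_powr s (?V n))
      \<le> (\<Sum>e. ennreal (c e powr s)) * (\<Sum>i. diam_powr s (U i))" .
qed

text \<open>Iterating \<open>contracted_cover\<close> from the one-set cover by \<open>F\<close>,
  \<open>m\<close> rounds give diameters at most \<open>q ^ m * D\<close> and an
  \<open>s\<close>-sum at most \<open>S ^ m * D powr s\<close>; both tend to 0.\<close>

proposition hausdorff_measure_eq_0_if_contracting:
  fixes f :: "nat \<Rightarrow> 'a::metric_space \<Rightarrow> 'a"
  assumes "bounded F" and F: "F \<subseteq> (\<Union>e. f e ` F)"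
    and lip: "\<And>e x y. x \<in> F \<Longrightarrow> y \<in> F \<Longrightarrow> dist (f e x) (f e y) \<le> c e * dist x y"
    and c: "\<And>e. 0 \<le> c e" "\<And>e. c e \<le> q" and "q < 1" and "0 < s"
    and S: "(\<Sum>e. ennreal (c e powr s)) \<le> ennreal S" "0 \<le> S" "S < 1"
  shows "hausdorff_measure s F = 0"
proof -
  have q: "0 \<le> q" using c order.trans by blast
  define D where "D = diameter F"
  define P where "P = (\<lambda>m U. F \<subseteq> (\<Union>i::nat. U i) \<and> (\<forall>i. bounded (U i) \<and> diameter (U i) \<le> q ^ m * D)
      \<and> (\<Sum>i. diam_powr s (U i)) \<le> ennreal (S ^ m * D powr s))"
  have cov: "\<exists>U. P m U" for m
  proof (induction m)
    case 0
    have "(\<Sum>i. diam_powr s (if i = 0 then F else {})) = diam_powr s F"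
      by (subst suminf_finite[of "{0::nat}"]) (auto simp: diam_powr_def)
    moreover have "diam_powr s F \<le> ennreal (D powr s)"
      using \<open>0 < s\<close> by (auto simp: diam_powr_def D_def)
    ultimately have "P 0 (\<lambda>i. if i = 0 then F else {})"
      using \<open>bounded F\<close> diameter_ge_0[of F] by (auto simp: P_def D_def)
    then show ?case by blast
  next
    case (Suc m)
    then obtain U where U: "P m U" by blast
    then obtain V where V: "F \<subseteq> (\<Union>i. V i)" "\<And>i. bounded (V i)"
      "\<And>i::nat. diameter (V i) \<le> q * (q ^ m * D)"
      "(\<Sum>i. diam_powr s (V i)) \<le> (\<Sum>e. ennreal (c e powr s)) * (\<Sum>i. diam_powr s (U i))"
      using contracted_cover[of F f c q s U "q ^ m * D"] F lip c \<open>0 < s\<close>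
      unfolding P_def by metis
    note V(4)
    also have "(\<Sum>e. ennreal (c e powr s)) * (\<Sum>i. diam_powr s (U i))
        \<le> ennreal S * ennreal (S ^ m * D powr s)"
      using S U unfolding P_def by (intro mult_mono) auto
    also have "\<dots> = ennreal (S ^ Suc m * D powr s)"
      using S by (simp add: ennreal_mult[symmetric] mult.assoc)
    finally have "P (Suc m) V" using V by (simp add: P_def mult.assoc)
    then show ?case by blast
  qed
  have "hausdorff_premeasure s \<delta> F = 0" if "0 < \<delta>" for \<delta>
  proof -
    have "(\<lambda>m. q ^ m * D) \<longlonglongrightarrow> 0 * D"
      using q \<open>q < 1\<close> by (intro tendsto_intros LIMSEQ_realpow_zero)
    then have "\<forall>\<^sub>F m in sequentially. q ^ m * D < \<delta>"
      using that by (intro order_tendstoD) auto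
    then have ev: "\<forall>\<^sub>F m in sequentially. hausdorff_premeasure s \<delta> F \<le> ennreal (S ^ m * D powr s)"
    proof eventually_elim
      case (elim m)
      obtain U where "P m U" using cov by blast
      then have "hausdorff_premeasure s \<delta> F \<le> (\<Sum>i. diam_powr s (U i))"
        using elim by (intro hausdorff_premeasure_le) (auto simp: P_def intro: order.trans less_imp_le)
      also have "\<dots> \<le> ennreal (S ^ m * D powr s)" using \<open>P m U\<close> by (simp add: P_def)
      finally show ?case .
    qed
    have "(\<lambda>m. ennreal (S ^ m * D powr s)) \<longlonglongrightarrow> ennreal (0 * D powr s)"
      using S by (intro tendsto_intros LIMSEQ_realpow_zero)
    from tendsto_lowerbound[OF this ev] show ?thesis by simp
  qed
  then show ?thesis by (simp add: hausdorff_measure_def)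
qed

section \<open>Premeasure bounded below for separated families\<close>

text \<open>Descent on the number of covering sets. The numbers \<open>r i\<close> merely bound the
  diameters, so a pulled-back cover can use \<open>r i / c e\<close> without any diameter being
  computed.\<close>

lemma separated_finite_cover:
  fixes f :: "'b \<Rightarrow> 'a::metric_space \<Rightarrow> 'a"
  assumes K: "K \<noteq> {}" "\<And>e x. e \<in> A \<Longrightarrow> x \<in> K \<Longrightarrow> f e x \<in> K"
    and A: "finite A" "2 \<le> card A"
    and c: "\<And>e. e \<in> A \<Longrightarrow> 0 < c e"
    and exp: "\<And>e x y. e \<in> A \<Longrightarrow> x \<in> K \<Longrightarrow> y \<in> K \<Longrightarrow> c e * dist x y \<le> dist (f e x) (f e y)"
    and sep: "\<And>e e' x y. e \<in> A \<Longrightarrow> e' \<in> A \<Longrightarrow> e \<noteq> e' \<Longrightarrow> x \<in> K \<Longrightarrow> y \<in> K \<Longrightarrow> \<delta> \<le> dist (f e x) (f e' y)"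
    and s: "0 < s" "0 < \<delta>" "1 \<le> (\<Sum>e\<in>A. c e powr s)"
  shows "finite I \<Longrightarrow> K \<subseteq> (\<Union>i\<in>I. U i) \<Longrightarrow> (\<And>i. i \<in> I \<Longrightarrow> 0 \<le> r i) \<Longrightarrow>
     (\<And>i x y. i \<in> I \<Longrightarrow> x \<in> U i \<Longrightarrow> y \<in> U i \<Longrightarrow> dist x y \<le> r i) \<Longrightarrow>
     \<delta> powr s \<le> (\<Sum>i\<in>I. r i powr s)"
proof (induction "card I" arbitrary: I U r rule: less_induct)
  case less
  show ?case
  proof (rule ccontr)
    define T where "T = (\<Sum>i\<in>I. r i powr s)"
    assume "\<not> ?case"
    then have T: "T < \<delta> powr s" by (simp add: T_def)
    \<comment> \<open>Hence no covering set can meet two different pieces, which are at least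
      \<delta> apart.\<close>
    have small: "r i < \<delta>" if "i \<in> I" for i
    proof -
      have "r i powr s \<le> T"
        unfolding T_def using that less.prems by (intro member_le_sum) auto
      then have "r i powr s < \<delta> powr s" using T by simp
      then show ?thesis using s powr_mono2[of s \<delta> "r i"] by (meson less_imp_le not_le)
    qed
    define C where "C = (\<lambda>e. {i \<in> I. U i \<inter> f e ` K \<noteq> {}})"
    have Cfin: "finite (C e)" and CI: "C e \<subseteq> I" for e using less.prems by (auto simp: C_def)
    have Cne: "C e \<noteq> {}" if "e \<in> A" for e
    proof -
      obtain x where "x \<in> K" using K by auto
      then have "f e x \<in> K" using K that by auto
      then obtain i where "i \<in> I" "f e x \<in> U i" using less.prems(2) by auto
      then show ?thesis using \<open>x \<in> K\<close> by (auto simp: C_def)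
    qed
    have Cdisj: "C e \<inter> C e' = {}" if "e \<in> A" "e' \<in> A" "e \<noteq> e'" for e e'
    proof (rule ccontr)
      assume "C e \<inter> C e' \<noteq> {}"
      then obtain i x y where i: "i \<in> I" "x \<in> K" "y \<in> K" "f e x \<in> U i" "f e' y \<in> U i"
        unfolding C_def by auto
      then have "dist (f e x) (f e' y) \<le> r i" using less.prems by auto
      then show False using sep[OF that i(2,3)] small[OF i(1)] by simp
    qed
    \<comment> \<open>Pigeonhole: otherwise the disjoint classes \<open>C e\<close> would together
      carry more than \<open>(\<Sum>e\<in>A. c e powr s) * T\<close>, which is at least
      \<open>T\<close>.\<close>
    have "\<exists>e\<in>A. (\<Sum>i\<in>C e. r i powr s) \<le> c e powr s * T"
    proof (rule ccontr)
      assume "\<not> ?thesis"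
      then have "(\<Sum>e\<in>A. c e powr s * T) < (\<Sum>e\<in>A. \<Sum>i\<in>C e. r i powr s)"
        using A by (intro sum_strict_mono) auto
      also have "\<dots> = (\<Sum>i\<in>(\<Union>e\<in>A. C e). r i powr s)"
        using A Cfin Cdisj by (intro sum.UNION_disjoint[symmetric]) auto
      also have "\<dots> \<le> T"
        unfolding T_def using less.prems(1) by (intro sum_mono2) (auto simp: C_def)
      finally have "(\<Sum>e\<in>A. c e powr s) * T < T" by (simp add: sum_distrib_right)
      moreover have "0 \<le> T" unfolding T_def by (intro sum_nonneg) auto
      ultimately show False using s(3) mult_right_mono[of 1 "\<Sum>e\<in>A. c e powr s" T] by simp
    qed
    then obtain e where e: "e \<in> A" "(\<Sum>i\<in>C e. r i powr s) \<le> c e powr s * T" by blast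
    \<comment> \<open>The class of a second index is nonempty and disjoint from \<open>C e\<close>,
      so passing to \<open>C e\<close> drops at least one set.\<close>
    obtain e' where e': "e' \<in> A" "e' \<noteq> e"
      using A e by (metis One_nat_def card_le_Suc0_iff_eq not_less_eq_eq numeral_2_eq_2)
    have "C e \<subset> I" using Cdisj[OF e(1) e'(1)] Cne[OF e'(1)] CI e' by blast
    then have card: "card (C e) < card I" using less.prems by (intro psubset_card_mono)
    \<comment> \<open>The preimages under \<open>f e\<close> of the sets in \<open>C e\<close> cover
      \<open>K\<close>. Rescaling divides their sum by \<open>c e powr s\<close>, which cancels the
      share just found, so the new sum is again at most \<open>T\<close>.\<close>
    have "\<delta> powr s \<le> (\<Sum>i\<in>C e. (r i / c e) powr s)"
    proof (rule less.hyps[OF card Cfin, where U = "\<lambda>i. {x \<in> K. f e x \<in> U i}"])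
      show "K \<subseteq> (\<Union>i\<in>C e. {x \<in> K. f e x \<in> U i})"
        using K(2)[OF e(1)] less.prems(2) by (fastforce simp: C_def)
      show "0 \<le> r i / c e" if "i \<in> C e" for i
        using less.prems(3)[of i] that CI[of e] c[OF e(1)] by (intro divide_nonneg_pos) auto
      show "dist x y \<le> r i / c e"
        if "i \<in> C e" "x \<in> {x \<in> K. f e x \<in> U i}" "y \<in> {x \<in> K. f e x \<in> U i}" for i x y
      proof -
        have "c e * dist x y \<le> dist (f e x) (f e y)" using that e exp by auto
        also have "\<dots> \<le> r i" using that CI[of e] by (intro less.prems(4)) auto
        finally show ?thesis using c[OF e(1)] by (simp add: field_simps)
      qed
    qed
    also have "\<dots> = (\<Sum>i\<in>C e. r i powr s) / c e powr s"
      unfolding sum_divide_distrib using c[OF e(1)] CI[of e] less.prems(3)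
      by (intro sum.cong) (auto simp: powr_divide subset_iff)
    also have "\<dots> \<le> T"
      using e(2) c[OF e(1)] by (simp add: field_simps)
    finally show False using T by simp
  qed
qed

text \<open>Finiteness of the cover comes from compactness, after fattening its members to open sets so that
  the \<open>i\<close>-th summand grows by \<open>\<eta> / 2\<^bsup>i+1\<^esup>\<close>.\<close>

proposition hausdorff_premeasure_ge_if_separated:
  fixes f :: "'b \<Rightarrow> 'a::metric_space \<Rightarrow> 'a"
  assumes "compact K"
    and K: "K \<noteq> {}" "\<And>e x. e \<in> A \<Longrightarrow> x \<in> K \<Longrightarrow> f e x \<in> K"
    and A: "finite A" "2 \<le> card A"
    and c: "\<And>e. e \<in> A \<Longrightarrow> 0 < c e"
    and exp: "\<And>e x y. e \<in> A \<Longrightarrow> x \<in> K \<Longrightarrow> y \<in> K \<Longrightarrow> c e * dist x y \<le> dist (f e x) (f e y)"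
    and sep: "\<And>e e' x y. e \<in> A \<Longrightarrow> e' \<in> A \<Longrightarrow> e \<noteq> e' \<Longrightarrow> x \<in> K \<Longrightarrow> y \<in> K \<Longrightarrow> \<delta> \<le> dist (f e x) (f e' y)"
    and s: "0 < s" "0 < \<delta>" "1 \<le> (\<Sum>e\<in>A. c e powr s)"
  shows "ennreal (\<delta> powr s) \<le> hausdorff_premeasure s \<rho> K"
  unfolding hausdorff_premeasure_def
proof (rule INF_greatest)
  fix U :: "nat \<Rightarrow> 'a set"
  assume "U \<in> {U. K \<subseteq> (\<Union>i. U i) \<and> (\<forall>i. bounded (U i) \<and> diameter (U i) \<le> \<rho>)}"
  then have U: "K \<subseteq> (\<Union>i. U i)" "\<And>i. bounded (U i)" by auto
  have d: "0 \<le> diameter (U i)" for i using U(2) by (rule diameter_ge_0)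
  show "ennreal (\<delta> powr s) \<le> (\<Sum>i. diam_powr s (U i))"
  proof (rule ennreal_le_epsilon)
    fix \<eta> :: real assume "0 < \<eta>"
    define g where "g = (\<lambda>i::nat. \<eta> * (1 / 2) ^ Suc i)"
    have g: "0 < g i" for i using \<open>0 < \<eta>\<close> by (simp add: g_def)
    define r where "r = (\<lambda>i. (diameter (U i) powr s + g i) powr (1 / s))"
    have r: "r i powr s = diameter (U i) powr s + g i" for i
      using g[of i] s by (simp add: r_def powr_powr add_nonneg_nonneg less_imp_le)
    have "diameter (U i) < r i" for i
    proof (rule ccontr)
      assume "\<not> ?thesis"
      then have "r i powr s \<le> diameter (U i) powr s"
        using s by (intro powr_mono2) (auto simp: r_def)
      then show False using r g[of i] by simp
    qed
    \<comment> \<open>Half of the gap, because each of two points of \<open>V i\<close> may lie up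
      to \<open>h i\<close> away from \<open>U i\<close>.\<close>
    define h where "h = (\<lambda>i. (r i - diameter (U i)) / 2)"
    have h: "0 < h i" for i using \<open>diameter (U i) < r i\<close> by (simp add: h_def)
    define V where "V = (\<lambda>i. \<Union>x\<in>U i. ball x (h i))"
    have "K \<subseteq> (\<Union>i\<in>UNIV. V i)"
    proof
      fix x assume "x \<in> K"
      then obtain i where "x \<in> U i" using U by auto
      then have "x \<in> V i" using h[of i] by (force simp: V_def)
      then show "x \<in> (\<Union>i\<in>UNIV. V i)" by blast
    qed
    moreover have "open (V i)" for i
      unfolding V_def by (intro open_UN ballI open_ball)
    ultimately obtain I where I: "finite I" "K \<subseteq> (\<Union>i\<in>I. V i)"
      using compactE_image[OF \<open>compact K\<close>] by metis
    have "\<delta> powr s \<le> (\<Sum>i\<in>I. r i powr s)"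
    proof (rule separated_finite_cover[OF K A c exp sep s I])
      show "0 \<le> r i" for i by (simp add: r_def)
      show "dist x y \<le> r i" if "x \<in> V i" "y \<in> V i" for i x y
      proof -
        obtain u v where uv: "u \<in> U i" "v \<in> U i" "dist u x < h i" "dist v y < h i"
          using \<open>x \<in> V i\<close> \<open>y \<in> V i\<close> by (auto simp: V_def)
        have "dist x y \<le> dist u x + dist u v + dist v y"
          by (smt (verit) dist_commute dist_triangle)
        moreover have "dist u v \<le> diameter (U i)" using uv U(2) by (intro diameter_bounded_bound)
        moreover have "r i = diameter (U i) + 2 * h i" by (simp add: h_def field_simps)
        ultimately show ?thesis using uv by linarith
      qed
    qed
    then have "ennreal (\<delta> powr s) \<le> ennreal (\<Sum>i\<in>I. r i powr s)" by (rule ennreal_leI)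
    also have "\<dots> = (\<Sum>i\<in>I. ennreal (diameter (U i) powr s) + ennreal (g i))"
      using g by (subst sum_ennreal[symmetric]) (auto simp: r less_imp_le)
    also have "\<dots> \<le> (\<Sum>i\<in>I. diam_powr s (U i) + ennreal (g i))"
      using s by (intro sum_mono add_right_mono) (auto simp: diam_powr_def)
    also have "\<dots> \<le> (\<Sum>i. diam_powr s (U i) + ennreal (g i))"
      using I by (intro sum_le_suminf) auto
    also have "\<dots> = (\<Sum>i. diam_powr s (U i)) + (\<Sum>i. ennreal (g i))"
      by (rule suminf_add[symmetric]) auto
    also have "(\<Sum>i. ennreal (g i)) = ennreal \<eta>"
    proof (rule suminf_ennreal_eq)
      show "g sums \<eta>"
        using sums_mult[OF power_half_series, of \<eta>] by (simp add: g_def)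
    qed (use g less_imp_le in blast)
    finally show "ennreal (\<delta> powr s) \<le> (\<Sum>i. diam_powr s (U i)) + ennreal \<eta>" .
  qed
qed

section \<open>Branches of the \<open>N\<close>-expansion\<close>

definition N_branch :: "nat \<Rightarrow> nat \<Rightarrow> real \<Rightarrow> real" where
  "N_branch N e y = real N / (real e + y)"

lemma dist_N_branch:
  assumes "0 < e" "0 \<le> x" "0 \<le> y"
  shows "dist (N_branch N e x) (N_branch N e y) = real N / ((real e + x) * (real e + y)) * dist x y"
proof -
  have "N_branch N e x - N_branch N e y = real N / ((real e + x) * (real e + y)) * (y - x)"
    using assms by (simp add: N_branch_def field_simps)
  then show ?thesis
    using assms by (simp add: dist_real_def abs_mult abs_minus_commute)
qed

lemma dist_N_branch_le:
  assumes "0 < e" "0 \<le> x" "0 \<le> y"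
  shows "dist (N_branch N e x) (N_branch N e y) \<le> real N / real e ^ 2 * dist x y"
  unfolding dist_N_branch[OF assms] power2_eq_square
  using assms by (intro mult_right_mono divide_left_mono mult_mono) auto

lemma dist_N_branch_ge:
  assumes "0 < e" "0 \<le> x" "0 \<le> y" "x \<le> 1" "y \<le> 1"
  shows "real N / (real e + 1) ^ 2 * dist x y \<le> dist (N_branch N e x) (N_branch N e y)"
  unfolding dist_N_branch[OF assms(1-3)] power2_eq_square
  using assms by (intro mult_right_mono divide_left_mono mult_mono mult_pos_pos) auto

text \<open>The digit is the integer part of \<open>e + y\<close>; at \<open>y = 1\<close> it would
  jump to \<open>e + 1\<close>.\<close>

lemma N_map_N_branch:
  assumes "0 < N" "0 < e" "0 \<le> y" "y < 1"
  shows "\<lfloor>real N / N_branch N e y\<rfloor> = int e" "N_map N (N_branch N e y) = y"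
proof -
  have eq: "real N / N_branch N e y = real e + y" "N_branch N e y \<noteq> 0"
    using assms by (auto simp: N_branch_def)
  show *: "\<lfloor>real N / N_branch N e y\<rfloor> = int e"
    unfolding eq using assms by linarith
  show "N_map N (N_branch N e y) = y"
    unfolding N_map_def * using eq by simp
qed

lemma N_digit_Suc:
  assumes "n \<ge> 1"
  shows "N_digit N (Suc n) x = N_digit N n (N_map N x)"
  using assms by (cases n) (auto simp: N_digit_def funpow_swap1)

text \<open>\<open>N / x\<close> splits into its integer part and \<open>N_map N x\<close>. A
  rational \<open>N_map N x\<close> would make \<open>x\<close> rational, and its digits are those
  of \<open>x\<close> shifted by one. So the set is covered by its own images under the
  branches.\<close>

lemma F_set_step:
  assumes "1 \<le> N" "x \<in> F_set \<alpha> N"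
  shows "N_map N x \<in> F_set \<alpha> N" "\<alpha> \<le> real_of_int \<lfloor>real N / x\<rfloor>"
    "x = real N / (real_of_int \<lfloor>real N / x\<rfloor> + N_map N x)"
proof -
  have x: "0 < x" "x \<notin> \<rat>" and d: "\<And>n. n \<ge> 1 \<Longrightarrow> real_of_int (N_digit N n x) \<ge> \<alpha>"
    using assms by (auto simp: F_set_def)
  define y where "y = N_map N x"
  have y: "real N / x = real_of_int \<lfloor>real N / x\<rfloor> + y" using x by (simp add: y_def N_map_def)
  show "\<alpha> \<le> real_of_int \<lfloor>real N / x\<rfloor>" using d[of 1] by (simp add: N_digit_def)
  show eq: "x = real N / (real_of_int \<lfloor>real N / x\<rfloor> + N_map N x)"
    unfolding y_def[symmetric] y[symmetric] using x assms(1) by simp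
  have "y \<notin> \<rat>"
  proof
    assume "y \<in> \<rat>"
    then have "real N / (real_of_int \<lfloor>real N / x\<rfloor> + y) \<in> \<rat>" by simp
    then show False using eq x y_def by simp
  qed
  moreover have "0 \<le> y" "y < 1" using y by linarith+
  moreover have "y \<noteq> 0" using \<open>y \<notin> \<rat>\<close> by auto
  moreover have "real_of_int (N_digit N n y) \<ge> \<alpha>" if "n \<ge> 1" for n
    using d[of "Suc n"] N_digit_Suc[OF that] by (simp add: y_def)
  ultimately show "N_map N x \<in> F_set \<alpha> N" by (auto simp: F_set_def y_def)
qed

text \<open>Euclid's algorithm: \<open>p / q\<close> is sent to \<open>(N * q mod p) / p\<close>,
  whose numerator is smaller. This later shows that a point whose orbit stays positive is
  irrational.\<close>

lemma N_map_iterate_eq_0_if_rat: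
  assumes "x \<in> \<rat>" "0 \<le> x"
  shows "\<exists>n. (N_map N ^^ n) x = 0"
proof -
  have "\<exists>n. (N_map N ^^ n) (real p / real q) = 0" for p q
  proof (induction p arbitrary: q rule: less_induct)
    case (less p)
    show ?case
    \<comment> \<open>For \<open>q = 0\<close> the quotient is 0 by the convention for division by
      zero.\<close>
    proof (cases "p = 0 \<or> q = 0")
      case True
      then have "(N_map N ^^ 0) (real p / real q) = 0" by auto
      then show ?thesis by blast
    next
      case False
      have "N_map N (real p / real q) = real (N * q) / real p - of_int \<lfloor>real (N * q) / real p\<rfloor>"
        using False by (simp add: N_map_def)
      also have "\<dots> = real (N * q) / real p - real (N * q div p)"
        unfolding floor_divide_of_nat_eq by simp
      also have "\<dots> = (real (N * q) - real p * real (N * q div p)) / real p"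
        using False by (simp add: field_simps)
      also have "real (N * q) - real p * real (N * q div p) = real (N * q mod p)"
        by (metis add_diff_cancel_left' mult_div_mod_eq of_nat_add of_nat_mult)
      finally have "N_map N (real p / real q) = real (N * q mod p) / real p" .
      moreover obtain n where "(N_map N ^^ n) (real (N * q mod p) / real p) = 0"
        using less[of "N * q mod p" p] False by auto
      ultimately have "(N_map N ^^ Suc n) (real p / real q) = 0"
        by (simp add: funpow_swap1)
      then show ?thesis by blast
    qed
  qed
  moreover obtain p q where "x = real p / real q"
    using Rats_abs_nat_div_natE[OF assms(1)] assms(2) by (metis abs_of_nonneg)
  ultimately show ?thesis by blast
qed

section \<open>The upper bound\<close>

text \<open>The quantity assumed to be less than 1 is \<open>N powr s\<close> times the integral of
  \<open>t powr (-2 * s)\<close> from \<open>\<alpha> - 1\<close> to infinity, which dominates the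
  sum of the contraction factors to the power \<open>s\<close>.\<close>

proposition hausdorff_measure_F_set_eq_0:
  assumes "1 \<le> N" "real N < \<alpha>" "1 / 2 < s"
    and S: "real N powr s * (\<alpha> - 1) powr (1 - 2 * s) / (2 * s - 1) < 1"
  shows "hausdorff_measure s (F_set \<alpha> N) = 0"
proof -
  \<comment> \<open>The least admissible digit; the branches are enumerated as
    \<open>a + k\<close>.\<close>
  define a where "a = nat \<lceil>\<alpha>\<rceil>"
  define \<theta> where "\<theta> = 2 * s - 1"
  have \<theta>: "0 < \<theta>" using assms by (simp add: \<theta>_def)
  have "\<alpha> \<le> real a" by (simp add: a_def real_nat_ceiling_ge)
  moreover have "1 < \<alpha>" using assms by linarith
  ultimately have a: "\<alpha> \<le> real a" "1 < real a" "real N < real a" "1 < \<alpha>"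
    using assms by linarith+
  define S where "S = real N powr s * (\<alpha> - 1) powr (1 - 2 * s) / (2 * s - 1)"
  \<comment> \<open>\<open>N powr s\<close> times the integral of
    \<open>t powr (-1 - \<theta>)\<close> from \<open>a + k - 1\<close> to infinity, so that
    \<open>g k - g (Suc k)\<close> majorizes the \<open>k\<close>-th summand.\<close>
  define g where "g = (\<lambda>k. real N powr s / \<theta> * (real (a + k) - 1) powr (-\<theta>))"
  show ?thesis
  proof (rule hausdorff_measure_eq_0_if_contracting)
    show "bounded (F_set \<alpha> N)"
      by (rule bounded_subset[of "{0..1}"]) (auto simp: F_set_def)
    show "F_set \<alpha> N \<subseteq> (\<Union>k. N_branch N (a + k) ` F_set \<alpha> N)"
    proof
      fix x assume x: "x \<in> F_set \<alpha> N"
      define e where "e = nat \<lfloor>real N / x\<rfloor>"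
      have "\<lceil>\<alpha>\<rceil> \<le> \<lfloor>real N / x\<rfloor>" using F_set_step(2)[OF assms(1) x] by linarith
      moreover have "0 < \<lceil>\<alpha>\<rceil>" using a by simp
      ultimately have e: "a \<le> e" "real_of_int \<lfloor>real N / x\<rfloor> = real e"
        unfolding a_def e_def by linarith+
      have "x = N_branch N (a + (e - a)) (N_map N x)"
        using F_set_step(3)[OF assms(1) x] e by (simp add: N_branch_def)
      then show "x \<in> (\<Union>k. N_branch N (a + k) ` F_set \<alpha> N)"
        using F_set_step(1)[OF assms(1) x] by blast
    qed
    show "dist (N_branch N (a + k) x) (N_branch N (a + k) y) \<le> real N / real (a + k) ^ 2 * dist x y"
      if "x \<in> F_set \<alpha> N" "y \<in> F_set \<alpha> N" for k x y
      using that a by (intro dist_N_branch_le) (auto simp: F_set_def)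
    show "0 \<le> real N / real (a + k) ^ 2" for k by simp
    show "real N / real (a + k) ^ 2 \<le> real N / real a" for k
    proof (rule divide_left_mono)
      have "real a \<le> real (a + k)" by simp
      also have "\<dots> \<le> real (a + k) ^ 2" using a by (intro self_le_power) auto
      finally show "real a \<le> real (a + k) ^ 2" .
    qed (use a in auto)
    show "real N / real a < 1" using a by simp
    show "0 < s" using assms by simp
    show "0 \<le> S" using assms by (simp add: S_def)
    show "S < 1" using assms by (simp add: S_def)
    have le: "(real N / real (a + k) ^ 2) powr s \<le> g k - g (Suc k)" for k
    proof -
      have pos: "0 < real (a + k)" "0 < real (a + k) - 1" using a by auto
      have "(real N / real (a + k) ^ 2) powr s = real N powr s * real (a + k) powr (-1 - \<theta>)"
      proof -
        have "real (a + k) ^ 2 = real (a + k) powr 2" using pos by simp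
        then have "(real (a + k) ^ 2) powr s = real (a + k) powr (2 * s)"
          by (simp only: powr_powr)
        then have "(real N / real (a + k) ^ 2) powr s = real N powr s / real (a + k) powr (2 * s)"
          by (simp add: powr_divide del: of_nat_add)
        also have "2 * s = -(-1 - \<theta>)" by (simp add: \<theta>_def)
        finally show ?thesis by (simp only: powr_minus_divide) simp
      qed
      also have "\<dots> \<le> real N powr s * (((real (a + k) - 1) powr (-\<theta>) - real (a + k) powr (-\<theta>)) / \<theta>)"
        using powr_diff_bounds(1)[OF pos(2) \<theta>] by (intro mult_left_mono) auto
      also have "\<dots> = g k - g (Suc k)"
        using \<theta> by (simp add: g_def field_simps)
      finally show ?thesis .
    qed
    have "g \<longlonglongrightarrow> real N powr s / \<theta> * 0"
      unfolding g_def using \<theta>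
      by (intro tendsto_intros tendsto_neg_powr) (real_asymp | simp)+
    from telescope_sums'[OF this] have sums: "(\<lambda>k. g k - g (Suc k)) sums g 0" by simp
    have "(\<Sum>k. ennreal ((real N / real (a + k) ^ 2) powr s)) \<le> (\<Sum>k. ennreal (g k - g (Suc k)))"
      using le by (intro suminf_le ennreal_leI) auto
    also have "\<dots> = ennreal (g 0)"
      using sums order.trans[OF powr_ge_zero le] by (intro suminf_ennreal_eq) auto
    also have "ennreal (g 0) \<le> ennreal S"
    proof (rule ennreal_leI)
      have "(real a - 1) powr (-\<theta>) \<le> (\<alpha> - 1) powr (-\<theta>)"
        using a assms \<theta> by (intro powr_mono2') auto
      then have "real N powr s / \<theta> * (real a - 1) powr (-\<theta>) \<le> real N powr s / \<theta> * (\<alpha> - 1) powr (-\<theta>)"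
        using \<theta> by (intro mult_left_mono) auto
      moreover have "S = real N powr s / \<theta> * (\<alpha> - 1) powr (-\<theta>)"
        by (simp add: S_def \<theta>_def)
      ultimately show "g 0 \<le> S" by (simp add: g_def)
    qed
    finally show "(\<Sum>k. ennreal ((real N / real (a + k) ^ 2) powr s)) \<le> ennreal S" .
  qed
qed

section \<open>The lower bound\<close>

text \<open>The iteration starts from the closed interval, not from its irrational points, to keep
  every stage compact; irrationality of the limit points is recovered afterwards.\<close>

definition cylinder_union :: "nat \<Rightarrow> nat set \<Rightarrow> nat \<Rightarrow> real set" where
  "cylinder_union N A n = ((\<lambda>X. \<Union>e\<in>A. N_branch N e ` X) ^^ n) {0..1}"

definition limit_set :: "nat \<Rightarrow> nat set \<Rightarrow> real set" where
  "limit_set N A = (\<Inter>n. cylinder_union N A n)"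

lemma cylinder_union_0: "cylinder_union N A 0 = {0..1}"
  and cylinder_union_Suc: "cylinder_union N A (Suc n) = (\<Union>e\<in>A. N_branch N e ` cylinder_union N A n)"
  by (simp_all add: cylinder_union_def)

text \<open>Digits strictly above \<open>N\<close> make the branches map \<open>{0..1}\<close> into
  the open unit interval; the digit \<open>N\<close> would send 0 to 1.\<close>

locale digit_set =
  fixes N :: nat and A :: "nat set"
  assumes N: "1 \<le> N" and fin: "finite A" and ne: "A \<noteq> {}" and gt: "\<And>e. e \<in> A \<Longrightarrow> N < e"
begin

lemma N_branch_bounds:
  assumes "e \<in> A" "0 \<le> y"
  shows "0 < N_branch N e y" "N_branch N e y \<le> N / e" "N_branch N e y < 1"
proof -
  have e: "real N < real e" "0 < real N" using gt assms N by auto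
  then show "0 < N_branch N e y" using assms unfolding N_branch_def
    by (intro divide_pos_pos) auto
  show 1: "N_branch N e y \<le> N / e" using assms e unfolding N_branch_def
    by (intro divide_left_mono mult_pos_pos) auto
  have "real N / real e < 1" using e by simp
  with 1 show "N_branch N e y < 1" by simp
qed

lemma cylinder_union_antimono: "cylinder_union N A (Suc n) \<subseteq> cylinder_union N A n"
proof (induction n)
  case 0
  show ?case
    using N_branch_bounds by (force simp: cylinder_union_0 cylinder_union_Suc less_imp_le)
next
  case (Suc n)
  then show ?case by (subst (1 2) cylinder_union_Suc) blast
qed

lemma cylinder_union_subset: "cylinder_union N A n \<subseteq> {0..1}"
proof (induction n)
  case (Suc n)
  then show ?case using cylinder_union_antimono[of n] by blast
qed (simp add: cylinder_union_0)

lemma compact_cylinder_union: "compact (cylinder_union N A n)"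
proof (induction n)
  case (Suc n)
  have "continuous_on (cylinder_union N A n) (N_branch N e)" if "e \<in> A" for e
    unfolding N_branch_def using cylinder_union_subset[of n] gt[OF that]
    by (intro continuous_intros) force
  then show ?case
    unfolding cylinder_union_Suc using Suc fin by (intro compact_UN compact_continuous_image) auto
qed (simp add: cylinder_union_0)

lemma cylinder_union_nonempty: "cylinder_union N A n \<noteq> {}"
  by (induction n) (use ne in \<open>auto simp: cylinder_union_0 cylinder_union_Suc\<close>)

lemma compact_limit_set: "compact (limit_set N A)"
  unfolding limit_set_def using compact_cylinder_union by (intro compact_Inter) auto

lemma limit_set_nonempty: "limit_set N A \<noteq> {}"
  unfolding limit_set_def
  using lift_Suc_antimono_le[of "cylinder_union N A", OF cylinder_union_antimono]
  by (intro compact_nest compact_cylinder_union cylinder_union_nonempty)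

lemma N_branch_in_limit_set:
  assumes "e \<in> A" "x \<in> limit_set N A"
  shows "N_branch N e x \<in> limit_set N A"
proof -
  have "N_branch N e x \<in> cylinder_union N A n" for n
    using assms cylinder_union_antimono[of n]
    unfolding limit_set_def cylinder_union_Suc by blast
  then show ?thesis by (simp add: limit_set_def)
qed

lemma limit_set_step:
  assumes x: "x \<in> limit_set N A"
  shows "0 < x" "x < 1" "nat \<lfloor>real N / x\<rfloor> \<in> A" "0 \<le> \<lfloor>real N / x\<rfloor>" "N_map N x \<in> limit_set N A"
proof -
  have mem: "x \<in> cylinder_union N A n" for n using x by (simp add: limit_set_def)
  have less1: "0 < y \<and> y < 1" if "y \<in> cylinder_union N A (Suc n)" for y n
    using that cylinder_union_subset[of n] N_branch_bounds unfolding cylinder_union_Suc by force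
  show "0 < x" "x < 1" using less1 mem by blast+
  \<comment> \<open>Going two stages deep puts the preimage \<open>y\<close> in a stage of positive
    index, hence strictly below 1, so that the digit can be read off.\<close>
  have *: "\<exists>e\<in>A. \<lfloor>real N / x\<rfloor> = int e \<and> N_map N x \<in> cylinder_union N A (Suc n)" for n
  proof -
    obtain e y where ey: "e \<in> A" "y \<in> cylinder_union N A (Suc n)" "x = N_branch N e y"
      using mem[of "Suc (Suc n)"] unfolding cylinder_union_Suc[of N A "Suc n"] by blast
    then show ?thesis
      using N_map_N_branch[of N e y] N less1[OF ey(2)] gt[OF ey(1)] by auto
  qed
  show "nat \<lfloor>real N / x\<rfloor> \<in> A" "0 \<le> \<lfloor>real N / x\<rfloor>" using *[of 0] by fastforce+
  have "N_map N x \<in> cylinder_union N A n" for n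
    using * cylinder_union_antimono[of n] by blast
  then show "N_map N x \<in> limit_set N A" by (simp add: limit_set_def)
qed

text \<open>The orbit of \<open>x\<close> stays in the limit set, so it never reaches 0, as the
  orbit of a rational point would; and each of its first digits lies in \<open>A\<close>.\<close>

lemma limit_set_subset_F_set:
  assumes "\<And>e. e \<in> A \<Longrightarrow> \<alpha> \<le> real e"
  shows "limit_set N A \<subseteq> F_set \<alpha> N"
proof
  fix x assume x: "x \<in> limit_set N A"
  have it: "(N_map N ^^ n) x \<in> limit_set N A" for n
    by (induction n) (use x limit_set_step in auto)
  have "x \<notin> \<rat>"
  proof
    assume "x \<in> \<rat>"
    then obtain n where "(N_map N ^^ n) x = 0"
      using N_map_iterate_eq_0_if_rat limit_set_step(1)[OF x] by (metis less_imp_le)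
    then show False using limit_set_step(1)[OF it[of n]] by simp
  qed
  moreover have "\<alpha> \<le> real_of_int (N_digit N n x)" for n
    using assms[OF limit_set_step(3)[OF it[of "n - 1"]]] limit_set_step(4)[OF it[of "n - 1"]]
    by (simp add: N_digit_def)
  ultimately show "x \<in> F_set \<alpha> N"
    using limit_set_step(1,2)[OF x] by (simp add: F_set_def)
qed

end

text \<open>The limit set of the digits from \<open>a\<close> to \<open>b\<close> is a compact
  subset with separated pieces; \<open>a < b\<close> supplies the two digits that the descent
  needs.\<close>

proposition hausdorff_premeasure_F_set_pos:
  fixes a b :: nat
  assumes "1 \<le> N" "N < a" "a < b" "\<alpha> \<le> real a" "0 < s"
    and sum: "1 \<le> (\<Sum>e=a..b. (real N / (real e + 1) ^ 2) powr s)"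
  shows "0 < hausdorff_premeasure s \<rho> (F_set \<alpha> N)"
proof -
  interpret digit_set N "{a..b}" using assms by unfold_locales auto
  let ?K = "limit_set N {a..b}"
  \<comment> \<open>Images of \<open>{0..1}\<close> under adjacent branches share an endpoint, but
    limit points are at most \<open>N / a\<close>. Hence denominators for different digits differ by
    at least \<open>1 - N / a\<close>, and each is at most \<open>b + 1\<close>.\<close>
  define \<delta> where "\<delta> = real N * (1 - real N / real a) / (real b + 1) ^ 2"
  have "real N / real a < 1" using assms by simp
  then have "0 < \<delta>" using assms by (auto simp: \<delta>_def)
  have K: "0 \<le> x" "x \<le> 1" "x \<le> real N / real a" if "x \<in> ?K" for x
  proof -
    show "0 \<le> x" "x \<le> 1" using limit_set_step(1,2)[OF that] by auto
    have "x \<in> cylinder_union N {a..b} (Suc 0)" using that by (auto simp: limit_set_def)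
    then obtain e y where e: "e \<in> {a..b}" "0 \<le> y" "x = N_branch N e y"
      unfolding cylinder_union_Suc cylinder_union_0 by auto
    have "x \<le> real N / real e" using e N_branch_bounds(2) by simp
    also have "\<dots> \<le> real N / real a" using e assms by (intro divide_left_mono) auto
    finally show "x \<le> real N / real a" .
  qed
  have sep: "\<delta> \<le> N_branch N e x - N_branch N e' y"
    if "e \<in> {a..b}" "e' \<in> {a..b}" "e < e'" "x \<in> ?K" "y \<in> ?K" for e e' x y
  proof -
    have pos: "0 < real e + x" "0 < real e' + y" using that assms K by (auto intro: add_pos_nonneg)
    have "(real e + x) * (real e' + y) \<le> (real b + 1) ^ 2"
      unfolding power2_eq_square using that K pos by (intro mult_mono add_mono) auto
    moreover have "1 - real N / real a \<le> (real e' + y) - (real e + x)"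
    proof -
      have "real e + 1 \<le> real e'" using that by simp
      then show ?thesis using K[OF that(4)] K[OF that(5)] by linarith
    qed
    ultimately have "\<delta> \<le> real N * ((real e' + y) - (real e + x)) / ((real e + x) * (real e' + y))"
      unfolding \<delta>_def using pos \<open>real N / real a < 1\<close>
      by (intro frac_le mult_left_mono mult_pos_pos mult_nonneg_nonneg) auto
    also have "\<dots> = N_branch N e x - N_branch N e' y"
      using pos by (simp add: N_branch_def field_simps)
    finally show ?thesis .
  qed
  have "ennreal (\<delta> powr s) \<le> hausdorff_premeasure s \<rho> ?K"
  proof (rule hausdorff_premeasure_ge_if_separated[where A = "{a..b}" and f = "N_branch N"
        and c = "\<lambda>e. real N / (real e + 1) ^ 2"])
    show "\<delta> \<le> dist (N_branch N e x) (N_branch N e' y)"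
      if "e \<in> {a..b}" "e' \<in> {a..b}" "e \<noteq> e'" "x \<in> ?K" "y \<in> ?K" for e e' x y
      using sep[of e e' x y] sep[of e' e y x] that unfolding dist_real_def by linarith
    show "real N / (real e + 1) ^ 2 * dist x y \<le> dist (N_branch N e x) (N_branch N e y)"
      if "e \<in> {a..b}" "x \<in> ?K" "y \<in> ?K" for e x y
      using that K assms by (intro dist_N_branch_ge) auto
    show "0 < real N / (real e + 1) ^ 2" if "e \<in> {a..b}" for e
      using assms by (auto intro!: divide_pos_pos zero_less_power)
  qed (use assms compact_limit_set limit_set_nonempty N_branch_in_limit_set \<open>0 < \<delta>\<close> in auto)
  also have "\<dots> \<le> hausdorff_premeasure s \<rho> (F_set \<alpha> N)"
    using assms by (intro hausdorff_premeasure_mono limit_set_subset_F_set) auto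
  finally have "ennreal (\<delta> powr s) \<le> hausdorff_premeasure s \<rho> (F_set \<alpha> N)" .
  moreover have "0 < ennreal (\<delta> powr s)" using \<open>0 < \<delta>\<close> by simp
  ultimately show ?thesis by (rule order.strict_trans2[rotated])
qed

section \<open>The explicit bounds in terms of \<alpha>\<close>

text \<open>Applying \<open>exp u \<ge> 1 + u\<close> twice turns the logarithmic condition into a
  linear one. The bound \<open>\<alpha> \<ge> real N\<close> rules out negative
  \<open>\<alpha> - 1\<close>, where the condition on \<open>ln\<close> could also hold.\<close>

lemma gt_if_exp_less_ln:
  assumes "\<alpha> \<ge> real N" "N \<ge> 1" "ln (\<alpha> - 1) > exp (1 + real N)"
  shows "real N + 3 < \<alpha>"
proof -
  \<comment> \<open>At \<open>\<alpha> = 1\<close> the convention \<open>ln 0 = 0\<close>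
    contradicts the assumption.\<close>
  have "\<alpha> \<noteq> 1" using assms exp_gt_zero[of "1 + real N"] by (intro notI) simp
  then have "1 < \<alpha>" using assms by linarith
  have "exp (1 + real N) + 1 \<le> exp (exp (1 + real N))"
    using exp_ge_add_one_self[of "exp (1 + real N)"] by linarith
  also have "\<dots> < exp (ln (\<alpha> - 1))" using assms(3) by simp
  also have "\<dots> = \<alpha> - 1" using \<open>1 < \<alpha>\<close> by simp
  finally show ?thesis using exp_ge_add_one_self[of "1 + real N"] by linarith
qed

text \<open>With \<open>\<theta> = 1 / ln (\<alpha> + 2)\<close> one has
  \<open>(\<alpha> + 2) powr (-\<theta>) = exp (-1)\<close>. As \<open>a + 1 < \<alpha> + 2\<close>,
  the full digit sum is at least \<open>exp (-1) / \<theta>\<close>, which exceeds 1 because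
  \<open>ln (\<alpha> + 2) > exp 1\<close>.\<close>

lemma lower_bound_le_hausdorff_dim:
  assumes "N \<ge> 1" "\<alpha> \<ge> real N" "ln (\<alpha> - 1) > exp (1 + real N)"
  shows "ereal (lower_bound \<alpha>) \<le> hausdorff_dim (F_set \<alpha> N)"
proof (rule hausdorff_dim_geI)
  define a where "a = nat \<lceil>\<alpha>\<rceil>"
  have \<alpha>: "real N + 3 < \<alpha>" using gt_if_exp_less_ln assms by blast
  have a: "\<alpha> \<le> real a" "real a < \<alpha> + 1"
    using \<alpha> by (auto simp: a_def) linarith+
  define \<theta> where "\<theta> = 1 / ln (\<alpha> + 2)"
  have "exp 1 < exp (1 + real N)" using assms by simp
  also have "\<dots> < ln (\<alpha> + 2)"
    using assms(3) \<alpha> ln_less_cancel_iff[of "\<alpha> - 1" "\<alpha> + 2"] by linarith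
  finally have ln: "exp 1 < ln (\<alpha> + 2)" .
  then have lnpos: "0 < ln (\<alpha> + 2)" using exp_gt_zero[of "1::real"] by linarith
  then have \<theta>: "0 < \<theta>" by (simp add: \<theta>_def)
  have "\<theta> < 1 / exp 1" unfolding \<theta>_def using ln by (intro divide_strict_left_mono mult_pos_pos lnpos) auto
  then have "\<theta> < exp (-1)" by (simp add: exp_minus inverse_eq_divide)
  have s: "lower_bound \<alpha> = (1 + \<theta>) / 2" by (simp add: lower_bound_def \<theta>_def)
  \<comment> \<open>The strict gap between \<theta> and \<open>exp (-1)\<close> pays for cutting the
    digit sum off at a finite \<open>b\<close>.\<close>
  have "(\<lambda>b. (real b + 2) powr (-\<theta>)) \<longlonglongrightarrow> 0"
    using \<theta> by (intro tendsto_neg_powr) (real_asymp | simp)+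
  then have "\<forall>\<^sub>F b in sequentially. (real b + 2) powr (-\<theta>) < exp (-1) - \<theta>"
    using \<open>\<theta> < exp (-1)\<close> by (intro order_tendstoD) auto
  with eventually_gt_at_top[of a] have "\<forall>\<^sub>F b in sequentially. a < b \<and> (real b + 2) powr (-\<theta>) < exp (-1) - \<theta>"
    by (rule eventually_conj)
  then obtain b where b: "a < b" "(real b + 2) powr (-\<theta>) < exp (-1) - \<theta>"
    using eventually_happens'[OF sequentially_bot] by blast
  show "0 < hausdorff_premeasure (lower_bound \<alpha>) 1 (F_set \<alpha> N)"
  proof (rule hausdorff_premeasure_F_set_pos)
    show "N < a" using a \<alpha> by linarith
    show "0 < lower_bound \<alpha>" using s \<theta> by simp
    \<comment> \<open>The integral of \<open>t powr (-1 - \<theta>)\<close> from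
      \<open>e + 1\<close> to infinity.\<close>
    define g where "g = (\<lambda>e::nat. (real e + 1) powr (-\<theta>) / \<theta>)"
    have "(\<alpha> + 2) powr (-\<theta>) = exp (-1)" using \<alpha> lnpos by (simp add: powr_def \<theta>_def)
    moreover have "(\<alpha> + 2) powr (-\<theta>) \<le> (real a + 1) powr (-\<theta>)"
      using a \<alpha> \<theta> by (intro powr_mono2') auto
    ultimately have "\<theta> \<le> (real a + 1) powr (-\<theta>) - (real b + 2) powr (-\<theta>)" using b by linarith
    then have "1 \<le> g a - g (b + 1)"
      using \<theta> by (simp add: g_def field_simps)
    also have "\<dots> = (\<Sum>e=a..b. g e - g (e + 1))"
      using b by (subst sum_natinterval_diff) auto
    also have "\<dots> \<le> (\<Sum>e=a..b. (real N / (real e + 1) ^ 2) powr lower_bound \<alpha>)"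
    proof (rule sum_mono)
      fix e
      have "g e - g (e + 1) = ((real e + 1) powr (-\<theta>) - (real e + 1 + 1) powr (-\<theta>)) / \<theta>"
        by (simp add: g_def diff_divide_distrib)
      also have "\<dots> \<le> (real e + 1) powr (-1 - \<theta>)"
        using \<theta> by (intro powr_diff_bounds) auto
      also have "\<dots> = (1 / (real e + 1) ^ 2) powr lower_bound \<alpha>"
      proof -
        have "1 / (real e + 1) ^ 2 = (real e + 1) powr (-2)"
          by (simp add: powr_minus_divide)
        moreover have "-2 * lower_bound \<alpha> = -1 - \<theta>" by (simp add: s)
        ultimately show ?thesis by (simp only: powr_powr)
      qed
      \<comment> \<open>Only \<open>N \<ge> 1\<close> enters here, which is why the lower bound does
        not depend on \<open>N\<close>.\<close>
      also have "\<dots> \<le> (real N / (real e + 1) ^ 2) powr lower_bound \<alpha>"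
        using assms s \<theta> by (intro powr_mono2 divide_right_mono) auto
      finally show "g e - g (e + 1) \<le> (real N / (real e + 1) ^ 2) powr lower_bound \<alpha>" .
    qed
    finally show "1 \<le> (\<Sum>e=a..b. (real N / (real e + 1) ^ 2) powr lower_bound \<alpha>)" .
  qed (use assms a b in auto)
qed

text \<open>For \<open>L = ln (\<alpha> - 1)\<close> the choice \<open>2 * s - 1 = ln L / L\<close>
  gives \<open>(\<alpha> - 1) powr (1 - 2 * s) = 1 / L\<close>, so the digit sum is at most
  \<open>N powr s / ln L\<close>. The threshold on \<alpha> says \<open>ln L > 1 + N\<close>, and
  \<open>s \<le> 1\<close>, so this is less than 1.\<close>

lemma hausdorff_dim_le_upper_bound:
  assumes "N \<ge> 1" "\<alpha> \<ge> real N" "ln (\<alpha> - 1) > exp (1 + real N)"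
  shows "hausdorff_dim (F_set \<alpha> N) \<le> ereal (upper_bound \<alpha>)"
proof -
  have \<alpha>: "real N + 3 < \<alpha>" using gt_if_exp_less_ln assms by blast
  define L where "L = ln (\<alpha> - 1)"
  have L: "exp (1 + real N) < L" using assms by (simp add: L_def)
  then have "0 < L" using exp_gt_zero[of "1 + real N"] by linarith
  have lnL: "1 + real N < ln L"
    using L \<open>0 < L\<close> by (metis exp_less_cancel_iff exp_ln)
  define s where "s = upper_bound \<alpha>"
  have s: "s = 1 / 2 + ln L / (2 * L)" by (simp add: s_def upper_bound_def L_def)
  have "0 < ln L / (2 * L)" using \<open>0 < L\<close> lnL by (intro divide_pos_pos) linarith+
  then have "1 / 2 < s" by (simp add: s)
  have "ln L \<le> L" using ln_le_minus_one[OF \<open>0 < L\<close>] by linarith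
  then have "s \<le> 1" using \<open>0 < L\<close> by (simp add: s field_simps)
  have "hausdorff_measure s (F_set \<alpha> N) = 0"
  proof (rule hausdorff_measure_F_set_eq_0)
    have \<theta>: "2 * s - 1 = ln L / L" using \<open>0 < L\<close> by (simp add: s field_simps)
    then have "1 - 2 * s = - (ln L / L)" by linarith
    then have "(\<alpha> - 1) powr (1 - 2 * s) = exp (- ln L)"
      using \<alpha> \<open>0 < L\<close> by (simp add: powr_def L_def[symmetric])
    also have "\<dots> = 1 / L" using \<open>0 < L\<close> by (simp add: exp_minus inverse_eq_divide)
    finally have "real N powr s * (\<alpha> - 1) powr (1 - 2 * s) / (2 * s - 1) = real N powr s / ln L"
      unfolding \<theta> using \<open>0 < L\<close> lnL by (simp add: field_simps)
    also have "real N powr s \<le> real N powr 1"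
      using assms \<open>s \<le> 1\<close> by (intro powr_mono) auto
    then have "real N powr s / ln L < 1" using lnL assms by simp
    finally show "real N powr s * (\<alpha> - 1) powr (1 - 2 * s) / (2 * s - 1) < 1" .
  qed (use assms(1) \<alpha> \<open>1 / 2 < s\<close> in \<open>linarith+\<close>)
  then show ?thesis
    unfolding hausdorff_dim_def s_def[symmetric] using \<open>1 / 2 < s\<close>
    by (intro Inf_lower) auto
qed

text \<open>Independence of \<open>N\<close> is expressed by bounds without an argument
  \<open>N\<close>, valid beyond a threshold chosen after \<open>N\<close>. Convergence from above
  is the filter \<open>at_right\<close>, and the logarithmic rates are the two \<Theta>
  statements.\<close>

theorem theorem1p2:
  shows "(\<forall>N::nat. N \<ge> 1 \<longrightarrow>
            (\<forall>\<alpha>::real. \<alpha> \<ge> real N \<and> ln (\<alpha> - 1) > exp (1 + real N) \<longrightarrow>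
               ereal (lower_bound \<alpha>) \<le> hausdorff_dim (F_set \<alpha> N) \<and>
               hausdorff_dim (F_set \<alpha> N) \<le> ereal (upper_bound \<alpha>)) \<and>
            ((\<lambda>\<alpha>. hausdorff_dim (F_set \<alpha> N)) \<longlongrightarrow> ereal (1 / 2)) at_top \<and>
            (\<exists>\<alpha>\<^sub>0. \<forall>\<alpha>\<ge>\<alpha>\<^sub>0.
               ereal (lower_bound \<alpha>) \<le> hausdorff_dim (F_set \<alpha> N) \<and>
               hausdorff_dim (F_set \<alpha> N) \<le> ereal (upper_bound \<alpha>))) \<and>
         filterlim lower_bound (at_right (1 / 2)) at_top \<and>
         filterlim upper_bound (at_right (1 / 2)) at_top \<and>
         (\<lambda>\<alpha>. lower_bound \<alpha> - 1 / 2) \<in> \<Theta>(\<lambda>\<alpha>. 1 / ln \<alpha>) \<and>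
         (\<lambda>\<alpha>. upper_bound \<alpha> - 1 / 2) \<in> \<Theta>(\<lambda>\<alpha>. ln (ln \<alpha>) / ln \<alpha>)"
proof (intro conjI allI impI)
  show lb: "filterlim lower_bound (at_right (1 / 2)) at_top"
    unfolding lower_bound_def by real_asymp
  show ub: "filterlim upper_bound (at_right (1 / 2)) at_top"
    unfolding upper_bound_def by real_asymp
  show "(\<lambda>\<alpha>. lower_bound \<alpha> - 1 / 2) \<in> \<Theta>(\<lambda>\<alpha>. 1 / ln \<alpha>)"
    unfolding lower_bound_def by real_asymp
  show "(\<lambda>\<alpha>. upper_bound \<alpha> - 1 / 2) \<in> \<Theta>(\<lambda>\<alpha>. ln (ln \<alpha>) / ln \<alpha>)"
    unfolding upper_bound_def by real_asymp
  fix N :: nat assume N: "N \<ge> 1"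
  show "ereal (lower_bound \<alpha>) \<le> hausdorff_dim (F_set \<alpha> N)"
    and "hausdorff_dim (F_set \<alpha> N) \<le> ereal (upper_bound \<alpha>)"
    if "real N \<le> \<alpha> \<and> exp (1 + real N) < ln (\<alpha> - 1)" for \<alpha>
    using that N lower_bound_le_hausdorff_dim hausdorff_dim_le_upper_bound by blast+
  then have bounds: "ereal (lower_bound \<alpha>) \<le> hausdorff_dim (F_set \<alpha> N) \<and>
      hausdorff_dim (F_set \<alpha> N) \<le> ereal (upper_bound \<alpha>)"
    if "real N \<le> \<alpha> \<and> exp (1 + real N) < ln (\<alpha> - 1)" for \<alpha>
    using that by blast
  \<comment> \<open>For fixed \<open>N\<close> the condition holds for all large \<alpha>, which
    gives both the threshold and the sandwich for the limit.\<close>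
  have "\<forall>\<^sub>F \<alpha> in at_top. real N \<le> \<alpha> \<and> exp (1 + real N) < ln (\<alpha> - 1)"
    by (intro eventually_conj) real_asymp+
  then have ev: "\<forall>\<^sub>F \<alpha> in at_top. ereal (lower_bound \<alpha>) \<le> hausdorff_dim (F_set \<alpha> N) \<and>
      hausdorff_dim (F_set \<alpha> N) \<le> ereal (upper_bound \<alpha>)"
    by (rule eventually_mono) (rule bounds)
  then show "\<exists>\<alpha>\<^sub>0. \<forall>\<alpha>\<ge>\<alpha>\<^sub>0. ereal (lower_bound \<alpha>) \<le> hausdorff_dim (F_set \<alpha> N) \<and>
      hausdorff_dim (F_set \<alpha> N) \<le> ereal (upper_bound \<alpha>)"
    by (simp add: eventually_at_top_linorder)
  show "((\<lambda>\<alpha>. hausdorff_dim (F_set \<alpha> N)) \<longlongrightarrow> ereal (1 / 2)) at_top"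
  proof (rule tendsto_sandwich)
    show "((\<lambda>\<alpha>. ereal (lower_bound \<alpha>)) \<longlongrightarrow> ereal (1 / 2)) at_top"
      using filterlim_at lb by (intro tendsto_ereal) blast
    show "((\<lambda>\<alpha>. ereal (upper_bound \<alpha>)) \<longlongrightarrow> ereal (1 / 2)) at_top"
      using filterlim_at ub by (intro tendsto_ereal) blast
  qed (use ev in \<open>auto elim: eventually_mono\<close>)
qed

end
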